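(* Let $s\in\mathbb{C}^N$. (a) If there exist $p\in[1,\infty]$, with conjugate exponent $q=p/(p-1)$ (i.e. $\tfrac1p+\tfrac1q=1$), such that $$\left\| W^{-1}Y_{LL}^{-1}\overline{W}^{-1}\right\|_p^{*}\,\|s\|_q<0.25,$$ then $\xi(s)<0.25$. (b) If there exist $p\in[1,\infty]$, with conjugate exponent $q=p/(p-1)$, and a real invertible diagonal matrix $\Lambda\in\mathbb{R}^{N\times N}$ such that $$\left\| W^{-1}Y_{LL}^{-1}\overline{W}^{-1}\Lambda\right\|_p^{*}\,\|\Lambda^{-1}s\|_q<0.25,$$ then $\xi(s)<0.25$.
   Context: Consider a network with one slack bus (index $0$) and $N$ $PQ$ buses (indices $1,\dots,N$). Its nodal admittance matrix is a complex $(N+1)\times(N+1)$ matrix partitioned as $$Y=\begin{bmatrix} Y_{00} & Y_{0L}\\ Y_{L0} & Y_{LL}\end{bmatrix},$$ with $Y_{00}$ a scalar, $Y_{0L}$ a $1\times N$ row, $Y_{L0}$ an $N\times 1$ column and $Y_{LL}$ an $N\times N$ matrix. Standing assumptions: $Y_{LL}$ is invertible, and $w := -Y_{LL}^{-1}Y_{L0}\in\mathbb{C}^N$ has all entries nonzero. Put $W := \mathrm{diag}(w)$. Bars denote (entrywise) complex conjugation. For $s\in\mathbb{C}^N$ define $$\xi(s) := \left\| W^{-1}Y_{LL}^{-1}\overline{W}^{-1}\mathrm{diag}(\overline{s})\right\|_\infty,$$ where for a complex matrix $A$, $\|A\|_\infty := \max_i\sum_j|A_{ij}|$. For a complex matrix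 $A$ and $p\in[1,\infty]$, $\|A\|_p^{*} := \max_h\|A_{h\bullet}\|_p$, where $A_{h\bullet}$ is the $h$-th row of $A$ and $\|\cdot\|_p$ is the $\ell_p$ norm of vectors. *)

theory Defs
  imports "HOL-Analysis.Analysis"
begin

text \<open>
  The PQ buses are indexed by the finite type \<open>'n\<close> (so \<open>N = CARD('n)\<close>) and all buses by
  \<open>'n option\<close>: \<open>None\<close> is the slack bus and \<open>Some i\<close> is the PQ bus \<open>i\<close>.
\<close>

definition Y_LL :: "complex ^ 'n option ^ 'n option \<Rightarrow> complex ^ 'n ^ 'n" where
  "Y_LL Y = (\<chi> i j. Y $ Some i $ Some j)"

definition Y_L0 :: "complex ^ 'n option ^ 'n option \<Rightarrow> complex ^ 'n" where
  "Y_L0 Y = (\<chi> i. Y $ Some i $ None)"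

definition diag_mat :: "'a::zero ^ 'n \<Rightarrow> 'a ^ 'n ^ 'n" where
  "diag_mat v = (\<chi> i j. if i = j then v $ i else 0)"

definition is_diag_mat :: "'a::zero ^ 'n ^ 'n \<Rightarrow> bool" where
  "is_diag_mat A \<longleftrightarrow> (\<forall>i j. i \<noteq> j \<longrightarrow> A $ i $ j = 0)"

definition cnj_vec :: "complex ^ 'n \<Rightarrow> complex ^ 'n" where
  "cnj_vec v = (\<chi> i. cnj (v $ i))"

definition load_w :: "complex ^ 'n option ^ 'n option \<Rightarrow> complex ^ 'n" where
  "load_w Y = - (matrix_inv (Y_LL Y) *v Y_L0 Y)"

definition load_W :: "complex ^ 'n option ^ 'n option \<Rightarrow> complex ^ 'n ^ 'n" where
  "load_W Y = diag_mat (load_w Y)"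

definition scaled_impedance :: "complex ^ 'n option ^ 'n option \<Rightarrow> complex ^ 'n ^ 'n" where
  "scaled_impedance Y =
     matrix_inv (load_W Y) ** matrix_inv (Y_LL Y) ** matrix_inv (map_matrix cnj (load_W Y))"

definition mat_inf_norm :: "complex ^ 'n ^ 'm \<Rightarrow> real" where
  "mat_inf_norm A = (MAX i. \<Sum>j\<in>UNIV. norm (A $ i $ j))"

text \<open>Only meant for \<open>p \<ge> 1\<close>; for \<open>p = \<infinity>\<close> it is the maximum norm.\<close>

definition lp_norm :: "ereal \<Rightarrow> complex ^ 'n \<Rightarrow> real" where
  "lp_norm p v =
     (if p = \<infinity> then (MAX i. norm (v $ i))
      else (\<Sum>i\<in>UNIV. norm (v $ i) powr real_of_ereal p) powr (1 / real_of_ereal p))"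

definition row_lp_norm :: "ereal \<Rightarrow> complex ^ 'n ^ 'm \<Rightarrow> real" where
  "row_lp_norm p A = (MAX h. lp_norm p (row h A))"

text \<open>On \<^typ>\<open>ereal\<close> we have \<open>1 / \<infinity> = 0\<close>, so this includes the pairs \<open>(1, \<infinity>)\<close> and \<open>(\<infinity>, 1)\<close>.\<close>

definition conjugate_exponents :: "ereal \<Rightarrow> ereal \<Rightarrow> bool" where
  "conjugate_exponents p q \<longleftrightarrow> 1 \<le> p \<and> 1 \<le> q \<and> 1 / p + 1 / q = 1"

definition xi :: "complex ^ 'n option ^ 'n option \<Rightarrow> complex ^ 'n \<Rightarrow> real" where
  "xi Y s = mat_inf_norm (scaled_impedance Y ** diag_mat (cnj_vec s))"

end

theory Submission
  imports Defs
begin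

text \<open>
  Row \<open>i\<close> of the matrix defining \<open>\<xi>(s)\<close> has absolute row sum \<open>\<Sum>\<^sub>j |A\<^sub>i\<^sub>j| |s\<^sub>j|\<close>, which Hoelder's
  inequality bounds by \<open>\<parallel>A\<^sub>i\<parallel>\<^sub>p \<parallel>s\<parallel>\<^sub>q\<close>. Part (b) reduces to the same bound because replacing
  \<open>(A, s)\<close> by \<open>(A\<Lambda>, \<Lambda>\<inverse>s)\<close> leaves every product \<open>|A\<^sub>i\<^sub>j| |s\<^sub>j|\<close> unchanged.
\<close>

text \<open>The classical normalisation argument: divide \<open>f\<close> and \<open>g\<close> by
  their \<open>p\<close>- and \<open>q\<close>-norms, apply Young's inequality to each product, and
  sum. The right-hand sides then add up to \<open>1 / p + 1 / q = 1\<close>.\<close>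

lemma Holder_inequality_sum:
  fixes p q :: real and f g :: "'a \<Rightarrow> real"
  assumes "finite I" "p > 1" "q > 1" "1 / p + 1 / q = 1"
    and f: "\<And>i. i \<in> I \<Longrightarrow> f i \<ge> 0" and g: "\<And>i. i \<in> I \<Longrightarrow> g i \<ge> 0"
  shows "(\<Sum>i\<in>I. f i * g i)
    \<le> (\<Sum>i\<in>I. f i powr p) powr (1 / p) * (\<Sum>i\<in>I. g i powr q) powr (1 / q)"
proof -
  define S where "S = (\<Sum>i\<in>I. f i powr p)"
  define T where "T = (\<Sum>i\<in>I. g i powr q)"
  have "S \<ge> 0" "T \<ge> 0"
    by (simp_all add: S_def T_def sum_nonneg)
  show ?thesis
  proof (cases "S = 0 \<or> T = 0")
    case True
    \<comment> \<open>Normalising is impossible here, but a vanishing sum of nonnegative powers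
      makes \<open>f\<close> or \<open>g\<close> vanish on all of \<open>I\<close>.\<close>
    then have "f i * g i = 0" if "i \<in> I" for i
      using \<open>finite I\<close> that by (auto simp: S_def T_def sum_nonneg_eq_0_iff)
    then have "(\<Sum>i\<in>I. f i * g i) = 0"
      by (intro sum.neutral) simp
    then show ?thesis
      by simp
  next
    case False
    then have pos: "S > 0" "T > 0"
      using \<open>S \<ge> 0\<close> \<open>T \<ge> 0\<close> by auto
    let ?a = "S powr (1 / p)" and ?b = "T powr (1 / q)"
    have "f i / ?a * (g i / ?b) \<le> f i powr p / S / p + g i powr q / T / q" if "i \<in> I" for i
    proof -
      have "f i / ?a * (g i / ?b) \<le> (f i / ?a) powr p / p + (g i / ?b) powr q / q"
        using assms that by (intro Youngs_inequality) auto
      also have "(f i / ?a) powr p = f i powr p / S"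
        using assms that pos by (simp add: powr_divide powr_powr)
      also have "(g i / ?b) powr q = g i powr q / T"
        using assms that pos by (simp add: powr_divide powr_powr)
      finally show ?thesis .
    qed
    then have "(\<Sum>i\<in>I. f i / ?a * (g i / ?b))
        \<le> (\<Sum>i\<in>I. f i powr p / S / p + g i powr q / T / q)"
      by (rule sum_mono)
    also have "\<dots> = S / S / p + T / T / q"
      by (simp only: sum.distrib S_def T_def sum_divide_distrib [symmetric])
    also have "\<dots> = 1"
      using pos assms by simp
    finally have "(\<Sum>i\<in>I. f i * g i) / (?a * ?b) \<le> 1"
      by (simp add: sum_divide_distrib)
    then have "(\<Sum>i\<in>I. f i * g i) \<le> ?a * ?b"
      using pos by (simp add: divide_le_eq)
    then show ?thesis
      by (simp only: S_def T_def)
  qed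
qed

lemma lp_norm_1: "lp_norm 1 v = (\<Sum>i\<in>UNIV. norm (v $ i))"
  by (simp add: lp_norm_def sum_nonneg)

lemma norm_nth_le_lp_norm_infinity: "norm (v $ i) \<le> lp_norm \<infinity> v"
  by (simp add: lp_norm_def)

lemma lp_norm_nonneg: "lp_norm p v \<ge> 0"
proof (cases "p = \<infinity>")
  case True
  then show ?thesis
    using norm_nth_le_lp_norm_infinity[of v] norm_ge_zero order_trans by blast
qed (simp add: lp_norm_def)

text \<open>Moves from extended reals to reals: as \<open>1 / \<infinity> = 0\<close>, an infinite
  exponent forces its partner to be 1, and two finite exponents both exceed 1, as Young's inequality
  is applied with.\<close>

lemma conjugate_exponents_cases:
  assumes "conjugate_exponents p q"
  obtains "p = 1" "q = \<infinity>"
    | "p = \<infinity>" "q = 1"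
    | a b where "p = ereal a" "q = ereal b" "a > 1" "b > 1" "1 / a + 1 / b = 1"
proof (cases p; cases q)
  fix a b assume pq: "p = ereal a" "q = ereal b"
  with assms have ge: "a \<ge> 1" "b \<ge> 1"
    by (simp_all add: conjugate_exponents_def one_ereal_def)
  with assms pq have "1 / a + 1 / b = 1"
    by (simp add: conjugate_exponents_def one_ereal_def)
  \<comment> \<open>If one exponent were 1, the reciprocal of the other would be 0; in HOL this
    happens only at 0, which \<open>ge\<close> excludes.\<close>
  moreover from this ge have "a \<noteq> 1" "b \<noteq> 1"
    by auto
  ultimately show thesis
    using ge pq that(3) by simp
next
  fix a assume pq: "p = ereal a" "q = \<infinity>"
  with assms have "a = 1"
    by (simp add: conjugate_exponents_def one_ereal_def split: if_splits)
  with pq show thesis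
    using that(1) by (simp add: one_ereal_def)
next
  fix b assume pq: "p = \<infinity>" "q = ereal b"
  with assms have "b = 1"
    by (simp add: conjugate_exponents_def one_ereal_def split: if_splits)
  with pq show thesis
    using that(2) by (simp add: one_ereal_def)
\<comment> \<open>What remains is contradictory: \<open>-\<infinity>\<close> lies below 1, and two
  infinite exponents would give \<open>0 + 0 = 1\<close>.\<close>
qed (use assms in \<open>auto simp: conjugate_exponents_def\<close>)

text \<open>At the endpoint pairs, each entry of one vector is bounded by its maximum norm, which
  then factors out of the sum. All other pairs are the real Hoelder inequality.\<close>

lemma lp_norm_Holder:
  fixes u v :: "complex ^ 'n"
  assumes "conjugate_exponents p q"
  shows "(\<Sum>j\<in>UNIV. norm (u $ j) * norm (v $ j)) \<le> lp_norm p u * lp_norm q v"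
  using assms
proof (cases rule: conjugate_exponents_cases)
  case 1
  then show ?thesis
    by (simp add: lp_norm_1 sum_distrib_right sum_mono mult_left_mono norm_nth_le_lp_norm_infinity)
next
  case 2
  then show ?thesis
    by (simp add: lp_norm_1 sum_distrib_left sum_mono mult_right_mono norm_nth_le_lp_norm_infinity)
next
  case (3 a b)
  then show ?thesis
    by (simp add: lp_norm_def Holder_inequality_sum)
qed

lemma matrix_mul_diag_mat_nth:
  fixes A :: "'a::semiring_1 ^ 'n ^ 'm"
  shows "(A ** diag_mat v) $ i $ j = A $ i $ j * v $ j"
  by (simp add: matrix_matrix_mult_def diag_mat_def if_distrib [of "\<lambda>x. _ * x"] cong: if_cong)

lemma mat_inf_norm_mul_diag_mat_le:
  fixes A :: "complex ^ 'n ^ 'm" and v :: "complex ^ 'n"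
  assumes "conjugate_exponents p q"
  shows "mat_inf_norm (A ** diag_mat v) \<le> row_lp_norm p A * lp_norm q v"
proof -
  have "(\<Sum>j\<in>UNIV. norm ((A ** diag_mat v) $ i $ j)) \<le> row_lp_norm p A * lp_norm q v" for i
  proof -
    have "(\<Sum>j\<in>UNIV. norm ((A ** diag_mat v) $ i $ j))
        = (\<Sum>j\<in>UNIV. norm (row i A $ j) * norm (v $ j))"
      by (simp add: matrix_mul_diag_mat_nth norm_mult row_def)
    also have "\<dots> \<le> lp_norm p (row i A) * lp_norm q v"
      using assms by (rule lp_norm_Holder)
    also have "\<dots> \<le> row_lp_norm p A * lp_norm q v"
      by (intro mult_right_mono lp_norm_nonneg) (simp add: row_lp_norm_def)
    finally show ?thesis .
  qed
  then show ?thesis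
    by (simp add: mat_inf_norm_def)
qed

text \<open>Bridges the conjugated \<open>s\<close> in \<open>xi\<close> and the plain
  \<open>s\<close> in the sufficient conditions.\<close>

lemma lp_norm_cnj_vec: "lp_norm p (cnj_vec v) = lp_norm p v"
  by (simp add: lp_norm_def cnj_vec_def)

lemma matrix_inv_right':
  fixes A :: "'a::semiring_1 ^ 'n ^ 'm"
  assumes "invertible A"
  shows "A ** matrix_inv A = mat 1"
  using assms unfolding invertible_def matrix_inv_def by (rule someI2_ex) simp

lemma is_diag_mat_mul_nth:
  fixes D :: "'a::semiring_1 ^ 'n ^ 'n"
  assumes "is_diag_mat D"
  shows "(D ** A) $ i $ j = D $ i $ i * A $ i $ j"
proof -
  have "(D ** A) $ i $ j = (\<Sum>k\<in>UNIV. if k = i then D $ i $ i * A $ i $ j else 0)"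
    unfolding matrix_matrix_mult_def vec_lambda_beta
    using assms by (intro sum.cong) (auto simp: is_diag_mat_def)
  then show ?thesis
    by simp
qed

text \<open>Entry \<open>(i, j)\<close> of \<open>D ** matrix_inv D = mat 1\<close> involves only
  \<open>D $ i $ i\<close>. The case \<open>i = j\<close> shows that this entry is nonzero and
  determines the inverse's diagonal; the other cases make the rest of the inverse vanish.\<close>

lemma matrix_inv_is_diag_mat:
  fixes D :: "'a::field ^ 'n ^ 'n"
  assumes "is_diag_mat D" "invertible D"
  shows "D $ i $ i \<noteq> 0"
    and "matrix_inv D = diag_mat (\<chi> i. inverse (D $ i $ i))"
proof -
  have *: "D $ i $ i * matrix_inv D $ i $ j = (if i = j then 1 else 0)" for i j
    using is_diag_mat_mul_nth[OF assms(1), of "matrix_inv D" i j] matrix_inv_right'[OF assms(2)]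
    by (simp add: mat_def)
  show nz: "D $ i $ i \<noteq> 0" for i
    using *[of i i] by auto
  have "matrix_inv D $ i $ j = (if i = j then inverse (D $ i $ i) else 0)" for i j
    using *[of i j] nz[of i] by (auto simp: inverse_unique split: if_splits)
  then show "matrix_inv D = diag_mat (\<chi> i. inverse (D $ i $ i))"
    by (simp add: vec_eq_iff diag_mat_def)
qed

lemma is_diag_mat_eq_diag_mat:
  "is_diag_mat D \<Longrightarrow> D = diag_mat (\<chi> i. D $ i $ i)"
  by (auto simp: is_diag_mat_def diag_mat_def vec_eq_iff)

lemma map_matrix_diag_mat:
  "f 0 = 0 \<Longrightarrow> map_matrix f (diag_mat v) = diag_mat (\<chi> i. f (v $ i))"
  by (simp add: diag_mat_def vec_eq_iff)

lemma diag_mat_vec_nth: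
  fixes v w :: "'a::semiring_1 ^ 'n"
  shows "(diag_mat v *v w) $ i = v $ i * w $ i"
  by (simp add: matrix_vector_mult_def diag_mat_def if_distrib [of "\<lambda>x. x * _"] cong: if_cong)

text \<open>Column \<open>j\<close> gains the factor \<open>\<Lambda> $ j $ j\<close> and the
  vector's entry \<open>j\<close> its inverse. They cancel despite the conjugation because \<Lambda>
  is real.\<close>

lemma matrix_mul_diag_mat_rescale:
  fixes A :: "complex ^ 'n ^ 'm" and \<Lambda> :: "real ^ 'n ^ 'n"
  assumes "is_diag_mat \<Lambda>" "invertible \<Lambda>"
  shows "(A ** map_matrix of_real \<Lambda>) ** diag_mat (cnj_vec (map_matrix of_real (matrix_inv \<Lambda>) *v s))
    = A ** diag_mat (cnj_vec s)"
proof -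
  have \<Lambda>: "map_matrix of_real \<Lambda> = diag_mat (\<chi> i. complex_of_real (\<Lambda> $ i $ i))"
    using is_diag_mat_eq_diag_mat[OF assms(1)] map_matrix_diag_mat[of complex_of_real]
    by (metis (no_types, lifting) of_real_0 vec_lambda_beta vec_lambda_unique)
  have \<Lambda>_inv: "map_matrix of_real (matrix_inv \<Lambda>)
      = diag_mat (\<chi> i. complex_of_real (inverse (\<Lambda> $ i $ i)))"
    unfolding matrix_inv_is_diag_mat(2)[OF assms] by (simp add: map_matrix_diag_mat)
  show ?thesis
    unfolding \<Lambda> \<Lambda>_inv vec_eq_iff using matrix_inv_is_diag_mat(1)[OF assms]
    by (simp add: matrix_mul_diag_mat_nth diag_mat_vec_nth cnj_vec_def)
qed

theorem mainTheorem3: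
  fixes Y :: "complex ^ ('n::finite) option ^ 'n option" and s :: "complex ^ 'n"
  assumes "invertible (Y_LL Y)"
    and "\<forall>i. load_w Y $ i \<noteq> 0"
  shows "((\<exists>p q. conjugate_exponents p q \<and>
             row_lp_norm p (scaled_impedance Y) * lp_norm q s < 0.25)
           \<longrightarrow> xi Y s < 0.25)
       \<and> ((\<exists>p q. \<exists>\<Lambda> :: real ^ 'n ^ 'n. conjugate_exponents p q \<and>
             is_diag_mat \<Lambda> \<and> invertible \<Lambda> \<and>
             row_lp_norm p (scaled_impedance Y ** map_matrix of_real \<Lambda>)
               * lp_norm q (map_matrix of_real (matrix_inv \<Lambda>) *v s) < 0.25)
           \<longrightarrow> xi Y s < 0.25)"
proof -
  have a: "xi Y s \<le> row_lp_norm p (scaled_impedance Y) * lp_norm q s"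
    if "conjugate_exponents p q" for p q
    using mat_inf_norm_mul_diag_mat_le[OF that, of "scaled_impedance Y" "cnj_vec s"]
    by (simp add: xi_def lp_norm_cnj_vec)
  \<comment> \<open>The general bound is applied to the rescaled pair, whose product is exactly the
    matrix inside \<open>xi Y s\<close>.\<close>
  have b: "xi Y s \<le> row_lp_norm p (scaled_impedance Y ** map_matrix of_real \<Lambda>)
      * lp_norm q (map_matrix of_real (matrix_inv \<Lambda>) *v s)"
    if "conjugate_exponents p q" "is_diag_mat \<Lambda>" "invertible \<Lambda>" for p q and \<Lambda> :: "real ^ 'n ^ 'n"
    using mat_inf_norm_mul_diag_mat_le[OF that(1), of "scaled_impedance Y ** map_matrix of_real \<Lambda>"
        "cnj_vec (map_matrix of_real (matrix_inv \<Lambda>) *v s)"]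
    by (simp add: xi_def lp_norm_cnj_vec matrix_mul_diag_mat_rescale[OF that(2,3)])
  show ?thesis
    using a b by (meson order.strict_trans1)
qed

end
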